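(* Let $X$ be a quasi-projective variety, $\Phi\colon X\dashrightarrow X$ a rational self-map, and $Y\subseteq X$ a subvariety, all defined over $\overline{\mathbb{Q}}$. If $x\in X_\Phi(\overline{\mathbb{Q}})$, then the set $\{n\in\mathbb{N}:\Phi^n(x)\in Y\}$ is the union of finitely many arithmetic progressions together with a set of upper asymptotic density zero.
   Context: $\mathbb{N}=\{0,1,2,\dots\}$. $X_\Phi(\overline{\mathbb{Q}})$ is the set of $x\in X(\overline{\mathbb{Q}})$ such that $\Phi^n(x)$ is not in the indeterminacy locus of $\Phi$ for every $n\in\mathbb{N}$. The upper asymptotic density of $A\subseteq\mathbb{N}$ is $\overline{d}(A)=\limsup_{m\to\infty}|A\cap[1,m]|/m$. *)

theory Defs
  imports
    "HOL-Analysis.Analysis"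
    "HOL-Algebra.Algebraic_Closure_Type"
    "HOL-Library.Poly_Mapping"
begin

section \<open>Projective space over the algebraic numbers\<close>

type_synonym qbar = "rat alg_closure"

text \<open>
  The type \<open>'n proj_space\<close> is the set of \<open>\<rat>\<close>-bar-points of projective \<open>N\<close>-space with
  \<open>CARD('n) = N + 1\<close>: its elements are the lines through the origin.
\<close>

typedef 'n proj_space =
  "{L :: (qbar ^ 'n::finite) set. \<exists>v. v \<noteq> 0 \<and> L = range (\<lambda>c. c *s v)}"
  morphisms line_of proj_of_line
proof -
  have "(1 :: qbar ^ 'n) \<noteq> 0"
    by (simp add: vec_eq_iff)
  then show ?thesis by blast
qed

definition hom_coords :: "'n::finite proj_space \<Rightarrow> (qbar ^ 'n) set" where
  "hom_coords P = line_of P - {0}"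


section \<open>Polynomials in finitely many variables\<close>

type_synonym 'n mpolynomial = "('n \<Rightarrow>\<^sub>0 nat) \<Rightarrow>\<^sub>0 qbar"

definition peval :: "'n::finite mpolynomial \<Rightarrow> qbar ^ 'n \<Rightarrow> qbar" where
  "peval p v = (\<Sum>m\<in>Poly_Mapping.keys p.
     Poly_Mapping.lookup p m * (\<Prod>i\<in>UNIV. v $ i ^ Poly_Mapping.lookup m i))"

definition homogeneous :: "nat \<Rightarrow> 'n::finite mpolynomial \<Rightarrow> bool" where
  "homogeneous d p \<longleftrightarrow>
     (\<forall>m\<in>Poly_Mapping.keys p. (\<Sum>i\<in>UNIV. Poly_Mapping.lookup m i) = d)"

lemma peval_superset:
  assumes "finite K" "Poly_Mapping.keys p \<subseteq> K"
  shows "peval p v = (\<Sum>m\<in>K.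
     Poly_Mapping.lookup p m * (\<Prod>i\<in>UNIV. v $ i ^ Poly_Mapping.lookup m i))"
  unfolding peval_def
  by (rule sum.mono_neutral_left) (use assms in \<open>auto simp: in_keys_iff\<close>)

lemma peval_zero [simp]: "peval 0 v = 0"
  by (simp add: peval_def)

lemma peval_one [simp]: "peval 1 v = 1"
  by (simp add: peval_def flip: single_one)

lemma peval_single:
  "peval (Poly_Mapping.single m c) v = c * (\<Prod>i\<in>UNIV. v $ i ^ Poly_Mapping.lookup m i)"
  by (simp add: peval_def)

lemma peval_add: "peval (p + q) v = peval p v + peval q v"
proof -
  let ?K = "Poly_Mapping.keys p \<union> Poly_Mapping.keys q"
  have "Poly_Mapping.keys (p + q) \<subseteq> ?K"
    by (rule Poly_Mapping.keys_add)
  then show ?thesis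
    by (simp add: peval_superset[of ?K] lookup_add algebra_simps sum.distrib)
qed

lemma peval_sum: "peval (sum f A) v = (\<Sum>a\<in>A. peval (f a) v)"
  by (induction A rule: infinite_finite_induct) (auto simp: peval_add)

lemma mpolynomial_as_sum:
  "(p :: 'n mpolynomial) =
     (\<Sum>m\<in>Poly_Mapping.keys p. Poly_Mapping.single m (Poly_Mapping.lookup p m))"
  by (rule poly_mapping_eqI)
     (auto simp: lookup_sum lookup_single when_def in_keys_iff)

lemma peval_mult: "peval (p * q) v = peval p v * peval q v"
proof -
  let ?s = "\<lambda>p. \<lambda>m. Poly_Mapping.single m (Poly_Mapping.lookup p m)"
  have single: "peval (?s p m * ?s q k) v = peval (?s p m) v * peval (?s q k) v" for m k
    by (simp add: mult_single peval_single lookup_add power_add prod.distrib algebra_simps)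
  have "p * q = (\<Sum>m\<in>Poly_Mapping.keys p. ?s p m) * (\<Sum>k\<in>Poly_Mapping.keys q. ?s q k)"
    using mpolynomial_as_sum[of p] mpolynomial_as_sum[of q] by simp
  then have "peval (p * q) v =
      peval (\<Sum>m\<in>Poly_Mapping.keys p. ?s p m) v * peval (\<Sum>k\<in>Poly_Mapping.keys q. ?s q k) v"
    by (simp add: sum_product peval_sum single)
  then show ?thesis
    by (simp flip: mpolynomial_as_sum)
qed

lemma homogeneous_one: "homogeneous 0 1"
  by (simp add: homogeneous_def flip: single_one)

lemma homogeneous_mult:
  assumes "homogeneous d p" "homogeneous e q"
  shows "homogeneous (d + e) (p * q)"
  unfolding homogeneous_def
proof
  fix m assume "m \<in> Poly_Mapping.keys (p * q)"
  then obtain a b where "m = a + b" "a \<in> Poly_Mapping.keys p" "b \<in> Poly_Mapping.keys q"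
    using keys_mult by blast
  then show "(\<Sum>i\<in>UNIV. Poly_Mapping.lookup m i) = d + e"
    using assms by (simp add: homogeneous_def lookup_add sum.distrib)
qed

lemma peval_scale:
  assumes "homogeneous d p"
  shows "peval p (c *s v) = c ^ d * peval p v"
proof -
  have "Poly_Mapping.lookup p m * (\<Prod>i\<in>UNIV. (c *s v) $ i ^ Poly_Mapping.lookup m i) =
        c ^ d * (Poly_Mapping.lookup p m * (\<Prod>i\<in>UNIV. v $ i ^ Poly_Mapping.lookup m i))"
    if "m \<in> Poly_Mapping.keys p" for m
  proof -
    have "(\<Sum>i\<in>UNIV. Poly_Mapping.lookup m i) = d"
      using that assms by (simp add: homogeneous_def)
    then show ?thesis
      by (simp add: power_mult_distrib prod.distrib algebra_simps flip: power_sum)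
  qed
  then show ?thesis
    unfolding peval_def sum_distrib_left by (intro sum.cong) auto
qed


section \<open>The Zariski topology\<close>

definition zero_locus :: "'n::finite mpolynomial set \<Rightarrow> 'n proj_space set" where
  "zero_locus S = {P. \<forall>p\<in>S. \<forall>v\<in>hom_coords P. peval p v = 0}"

definition algebraic_set :: "'n::finite proj_space set \<Rightarrow> bool" where
  "algebraic_set C \<longleftrightarrow> (\<exists>S. (\<forall>p\<in>S. \<exists>d. homogeneous d p) \<and> C = zero_locus S)"

definition zariski :: "'n::finite proj_space topology" where
  "zariski = topology (\<lambda>U. algebraic_set (- U))"

lemma hom_coordsE:
  assumes "v \<in> hom_coords P" "w \<in> hom_coords P"
  obtains c where "c \<noteq> 0" "w = c *s v"
proof -
  obtain u where u: "line_of P = range (\<lambda>c. c *s u)"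
    using line_of[of P] by auto
  obtain a b where ab: "v = a *s u" "w = b *s u"
    using assms u by (auto simp: hom_coords_def)
  have "a \<noteq> 0" "b \<noteq> 0"
    using assms ab by (auto simp: hom_coords_def)
  then have "b / a \<noteq> 0" "w = (b / a) *s v"
    by (simp_all add: ab vector_smult_assoc)
  then show ?thesis using that by blast
qed

lemma hom_coords_nonempty: "\<exists>v. v \<in> hom_coords P"
proof -
  obtain u where "u \<noteq> 0" "line_of P = range (\<lambda>c. c *s u)"
    using line_of[of P] by auto
  then have "u \<in> hom_coords P"
    by (auto simp: hom_coords_def intro: range_eqI[of _ _ 1])
  then show ?thesis by blast
qed

lemma peval_zero_hom_coords:
  assumes "homogeneous d p" "v \<in> hom_coords P" "w \<in> hom_coords P" "peval p v = 0"
  shows "peval p w = 0"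
proof -
  obtain c where "w = c *s v"
    using hom_coordsE[OF assms(2,3)] by blast
  then show ?thesis
    using assms by (simp add: peval_scale)
qed

lemma algebraic_set_Un:
  assumes "algebraic_set C" "algebraic_set D"
  shows "algebraic_set (C \<union> D)"
proof -
  obtain S T where S: "\<forall>p\<in>S. \<exists>d. homogeneous d p" "C = zero_locus S"
    and T: "\<forall>p\<in>T. \<exists>d. homogeneous d p" "D = zero_locus T"
    using assms by (auto simp: algebraic_set_def)
  let ?ST = "{p * q | p q. p \<in> S \<and> q \<in> T}"
  have hom: "\<forall>r\<in>?ST. \<exists>d. homogeneous d r"
    using S(1) T(1) homogeneous_mult by blast
  have "P \<in> C \<union> D" if "P \<in> zero_locus ?ST" for P
  proof (rule ccontr)
    assume "P \<notin> C \<union> D"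
    then obtain p q v w where pq: "p \<in> S" "q \<in> T" "v \<in> hom_coords P" "w \<in> hom_coords P"
        "peval p v \<noteq> 0" "peval q w \<noteq> 0"
      by (auto simp: S T zero_locus_def)
    then have "peval q v \<noteq> 0"
      using T(1) peval_zero_hom_coords by blast
    then have "peval (p * q) v \<noteq> 0"
      using pq by (simp add: peval_mult)
    moreover have "peval (p * q) v = 0"
      using that pq by (auto simp: zero_locus_def)
    ultimately show False by simp
  qed
  moreover have "C \<union> D \<subseteq> zero_locus ?ST"
    by (auto simp: S T zero_locus_def peval_mult)
  ultimately have "C \<union> D = zero_locus ?ST"
    by blast
  with hom show ?thesis
    unfolding algebraic_set_def by blast
qed

lemma algebraic_set_Inter:
  assumes "\<And>C. C \<in> \<C> \<Longrightarrow> algebraic_set C"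
  shows "algebraic_set (\<Inter>\<C>)"
proof -
  obtain S where S: "\<And>C. C \<in> \<C> \<Longrightarrow> (\<forall>p\<in>S C. \<exists>d. homogeneous d p) \<and> C = zero_locus (S C)"
    using assms unfolding algebraic_set_def by metis
  have "zero_locus (\<Union>C\<in>\<C>. S C) = (\<Inter>C\<in>\<C>. zero_locus (S C))"
    by (auto simp: zero_locus_def)
  also have "\<dots> = \<Inter>\<C>"
    using S by auto
  finally show ?thesis
    unfolding algebraic_set_def using S by (intro exI[of _ "\<Union>C\<in>\<C>. S C"]) auto
qed

lemma istopology_zariski: "istopology (\<lambda>U. algebraic_set (- U))"
  unfolding istopology_def
proof (intro conjI allI impI)
  fix U V :: "'a proj_space set"
  assume "algebraic_set (- U)" "algebraic_set (- V)"
  then show "algebraic_set (- (U \<inter> V))"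
    by (simp add: algebraic_set_Un)
next
  fix \<U> :: "'a proj_space set set"
  assume "\<forall>U\<in>\<U>. algebraic_set (- U)"
  then have "algebraic_set (\<Inter>(uminus ` \<U>))"
    by (intro algebraic_set_Inter) auto
  then show "algebraic_set (- \<Union>\<U>)"
    by (simp add: Compl_UN uminus_Sup)
qed

lemma openin_zariski: "openin zariski U \<longleftrightarrow> algebraic_set (- U)"
  by (simp add: zariski_def topology_inverse'[OF istopology_zariski])

lemma topspace_zariski [simp]: "topspace zariski = UNIV"
proof -
  have "zero_locus {1} = {}"
    using hom_coords_nonempty by (auto simp: zero_locus_def)
  then have "openin zariski (UNIV :: 'a proj_space set)"
    unfolding openin_zariski algebraic_set_def
    by (intro exI[of _ "{1}"]) (auto intro: homogeneous_one)
  then show ?thesis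
    using openin_subset by blast
qed

lemma closedin_zariski: "closedin zariski C \<longleftrightarrow> algebraic_set C"
  by (simp add: closedin_def openin_zariski Compl_eq_Diff_UNIV [symmetric])


section \<open>Quasi-projective varieties and morphisms\<close>

text \<open>
  Varieties are identified with their sets of \<open>\<rat>\<close>-bar-points; they are reduced but not
  required to be irreducible.
\<close>

definition quasi_projective_variety :: "'n::finite proj_space set \<Rightarrow> bool" where
  "quasi_projective_variety \<X> \<longleftrightarrow>
     (\<exists>U C. openin zariski U \<and> closedin zariski C \<and> \<X> = U \<inter> C)"

abbreviation zariski_on :: "'n::finite proj_space set \<Rightarrow> 'n proj_space topology" where
  "zariski_on \<X> \<equiv> subtopology zariski \<X>"

definition subvariety :: "'n::finite proj_space set \<Rightarrow> 'n proj_space set \<Rightarrow> bool" where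
  "subvariety \<Y> \<X> \<longleftrightarrow> closedin (zariski_on \<X>) \<Y>"

definition regular_function :: "'n::finite proj_space set \<Rightarrow> ('n proj_space \<Rightarrow> qbar) \<Rightarrow> bool" where
  "regular_function V f \<longleftrightarrow>
     (\<forall>P\<in>V. \<exists>W p q d. openin (zariski_on V) W \<and> P \<in> W \<and> homogeneous d p \<and> homogeneous d q \<and>
        (\<forall>Q\<in>W. \<forall>v\<in>hom_coords Q. peval q v \<noteq> 0 \<and> f Q = peval p v / peval q v))"

definition morphism ::
  "'n::finite proj_space set \<Rightarrow> 'm::finite proj_space set \<Rightarrow> ('n proj_space \<Rightarrow> 'm proj_space) \<Rightarrow> bool"
where
  "morphism \<X> \<Y> f \<longleftrightarrow>
     continuous_map (zariski_on \<X>) (zariski_on \<Y>) f \<and>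
     (\<forall>V g. openin (zariski_on \<Y>) V \<longrightarrow> regular_function V g \<longrightarrow>
        regular_function {x \<in> \<X>. f x \<in> V} (g \<circ> f))"


section \<open>Rational maps\<close>

definition dense_open :: "'n::finite proj_space set \<Rightarrow> 'n proj_space set \<Rightarrow> bool" where
  "dense_open \<X> U \<longleftrightarrow> openin (zariski_on \<X>) U \<and> zariski_on \<X> closure_of U = \<X>"

type_synonym ('n, 'm) partial_map = "'n proj_space set \<times> ('n proj_space \<Rightarrow> 'm proj_space)"

definition partial_morphisms ::
  "'n::finite proj_space set \<Rightarrow> 'm::finite proj_space set \<Rightarrow> ('n, 'm) partial_map set"
where
  "partial_morphisms \<X> \<Y> = {(U, f). dense_open \<X> U \<and> morphism U \<Y> f}"

definition rational_equiv ::
  "'n::finite proj_space set \<Rightarrow> 'm::finite proj_space set \<Rightarrow>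
     (('n, 'm) partial_map \<times> ('n, 'm) partial_map) set"
where
  "rational_equiv \<X> \<Y> =
     {((U, f), (V, g)). (U, f) \<in> partial_morphisms \<X> \<Y> \<and> (V, g) \<in> partial_morphisms \<X> \<Y> \<and>
        (\<exists>W. dense_open \<X> W \<and> W \<subseteq> U \<inter> V \<and> (\<forall>x\<in>W. f x = g x))}"

definition rational_maps ::
  "'n::finite proj_space set \<Rightarrow> 'm::finite proj_space set \<Rightarrow> ('n, 'm) partial_map set set"
where
  "rational_maps \<X> \<Y> = partial_morphisms \<X> \<Y> // rational_equiv \<X> \<Y>"

lemma dense_open_Int:
  assumes "dense_open \<X> U" "dense_open \<X> V"
  shows "dense_open \<X> (U \<inter> V)"
proof -
  have "zariski_on \<X> closure_of (U \<inter> V) = zariski_on \<X> closure_of U"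
    using assms closure_of_openin_Int_superset[of "zariski_on \<X>" U V]
    by (auto simp: dense_open_def dest: openin_subset)
  then show ?thesis
    using assms by (simp add: dense_open_def openin_Int)
qed

lemma equiv_rational_equiv: "equiv (partial_morphisms \<X> \<Y>) (rational_equiv \<X> \<Y>)"
proof (rule equivI)
  show "rational_equiv \<X> \<Y> \<subseteq> partial_morphisms \<X> \<Y> \<times> partial_morphisms \<X> \<Y>"
    by (auto simp: rational_equiv_def)
  show "refl_on (partial_morphisms \<X> \<Y>) (rational_equiv \<X> \<Y>)"
    by (auto simp: refl_on_def rational_equiv_def partial_morphisms_def)
  show "sym (rational_equiv \<X> \<Y>)"
    unfolding sym_def rational_equiv_def by (fastforce simp: Int_commute)
  show "trans (rational_equiv \<X> \<Y>)"
  proof (rule transI)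
    fix F G H
    assume "(F, G) \<in> rational_equiv \<X> \<Y>" "(G, H) \<in> rational_equiv \<X> \<Y>"
    then obtain U f V g S h W W' where
      FGH: "F = (U, f)" "G = (V, g)" "H = (S, h)"
        "F \<in> partial_morphisms \<X> \<Y>" "H \<in> partial_morphisms \<X> \<Y>"
      and W: "dense_open \<X> W" "W \<subseteq> U \<inter> V" "\<forall>x\<in>W. f x = g x"
      and W': "dense_open \<X> W'" "W' \<subseteq> V \<inter> S" "\<forall>x\<in>W'. g x = h x"
      unfolding rational_equiv_def by blast
    have "dense_open \<X> (W \<inter> W')" "W \<inter> W' \<subseteq> U \<inter> S" "\<forall>x\<in>W \<inter> W'. f x = h x"
      using W W' dense_open_Int by auto
    with FGH show "(F, H) \<in> rational_equiv \<X> \<Y>"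
      unfolding rational_equiv_def by blast
  qed
qed

definition rat_domain :: "('n, 'm) partial_map set \<Rightarrow> 'n::finite proj_space set" where
  "rat_domain \<Phi> = (\<Union>(U, f)\<in>\<Phi>. U)"

definition indeterminacy_locus ::
  "'n::finite proj_space set \<Rightarrow> ('n, 'm) partial_map set \<Rightarrow> 'n proj_space set"
where
  "indeterminacy_locus \<X> \<Phi> = \<X> - rat_domain \<Phi>"

text \<open>
  On \<open>rat_domain \<Phi>\<close> all representatives defined at \<open>x\<close> take the same value there, because
  quasi-projective varieties are separated. Outside of it \<open>rat_apply \<Phi> x\<close> is unspecified.
\<close>

definition rat_apply :: "('n, 'm) partial_map set \<Rightarrow> 'n::finite proj_space \<Rightarrow> 'm::finite proj_space"
where
  "rat_apply \<Phi> x = (THE y. \<exists>(U, f)\<in>\<Phi>. x \<in> U \<and> y = f x)"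

definition rat_iterate ::
  "('n, 'n) partial_map set \<Rightarrow> nat \<Rightarrow> 'n::finite proj_space \<Rightarrow> 'n proj_space"
where
  "rat_iterate \<Phi> n x = (rat_apply \<Phi> ^^ n) x"

definition well_defined_orbit_points ::
  "'n::finite proj_space set \<Rightarrow> ('n, 'n) partial_map set \<Rightarrow> 'n proj_space set"
where
  "well_defined_orbit_points \<X> \<Phi> =
     {x \<in> \<X>. \<forall>n. rat_iterate \<Phi> n x \<notin> indeterminacy_locus \<X> \<Phi>}"


section \<open>Arithmetic progressions and density\<close>

definition arithmetic_progression :: "nat set \<Rightarrow> bool" where
  "arithmetic_progression A \<longleftrightarrow> (\<exists>a d. d > 0 \<and> A = range (\<lambda>k. a + k * d))"

definition upper_density :: "nat set \<Rightarrow> ereal" where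
  "upper_density A = limsup (\<lambda>m. ereal (real (card (A \<inter> {1..m})) / real m))"

end

theory Submission
  imports Defs
begin

text \<open>
  Two facts about the orbit of \<open>x\<close> suffice: the Zariski topology is Noetherian, and \<open>\<Phi>\<close> is
  continuous on its domain, so that for every \<open>k\<close> the condition \<open>\<Phi>\<^sup>n\<^sup>+\<^sup>k(x) \<in> C\<close> on \<open>n\<close> reads
  \<open>\<Phi>\<^sup>n(x) \<in> B\<close> for a closed set \<open>B\<close>. By Noetherian induction on a closed set \<open>C\<close>, let \<open>N\<close> be its
  set of return times. If \<open>N + k \<subseteq> N\<close> for some \<open>k \<ge> 1\<close>, then \<open>N\<close> is a finite union of progressions.
  Otherwise the induction hypothesis applies to \<open>N \<inter> (N - k)\<close> for all \<open>k \<ge> 1\<close>. If all of these have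
  density zero, so has \<open>N\<close>, because a set with gaps at least \<open>k\<close> has upper density at most \<open>1 / k\<close>.
  If not, \<open>N\<close> contains a progression of some difference \<open>d\<close> and is therefore, up to a finite set,
  the union of the \<open>N \<inter> (N - e)\<close> with \<open>1 \<le> e \<le> d\<close>.
\<close>

section \<open>Upper density\<close>

lemma upper_density_nonneg: "0 \<le> upper_density A"
  unfolding upper_density_def by (rule le_Limsup) auto

lemma upper_density_Un_le: "upper_density (A \<union> B) \<le> upper_density A + upper_density B"
proof -
  have "real (card ((A \<union> B) \<inter> {1..m})) \<le> real (card (A \<inter> {1..m})) + real (card (B \<inter> {1..m}))"
    for m
    by (metis Int_Un_distrib2 card_Un_le of_nat_add of_nat_le_iff)
  then have "upper_density (A \<union> B) \<le> limsup (\<lambda>m. ereal (real (card (A \<inter> {1..m})) / real m) +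
      ereal (real (card (B \<inter> {1..m})) / real m))"
    unfolding upper_density_def
    by (intro Limsup_mono always_eventually allI)
       (simp add: divide_right_mono flip: add_divide_distrib)
  also have "\<dots> \<le> upper_density A + upper_density B"
    unfolding upper_density_def by (rule ereal_limsup_add_mono)
  finally show ?thesis .
qed

lemma upper_density_le_if_tendsto:
  assumes "\<And>m. m > 0 \<Longrightarrow> real (card (A \<inter> {1..m})) / real m \<le> f m" "f \<longlonglongrightarrow> l"
  shows "upper_density A \<le> ereal l"
proof -
  have "upper_density A \<le> limsup (\<lambda>m. ereal (f m))"
    unfolding upper_density_def
    by (intro Limsup_mono eventually_mono[OF eventually_gt_at_top[of 0]]) (use assms(1) in auto)
  also have "limsup (\<lambda>m. ereal (f m)) = ereal l"
    using assms(2) by (intro lim_imp_Limsup) auto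
  finally show ?thesis .
qed

lemma upper_density_finite:
  assumes "finite A"
  shows "upper_density A = 0"
proof -
  have "upper_density A \<le> ereal 0"
  proof (rule upper_density_le_if_tendsto[OF _ lim_const_over_n])
    show "real (card (A \<inter> {1..m})) / real m \<le> real (card A) / real m" for m
      using assms by (intro divide_right_mono) (auto intro!: card_mono)
  qed
  then show ?thesis
    using upper_density_nonneg[of A] by (simp flip: zero_ereal_def)
qed

lemma upper_density_Un_eq_0:
  "upper_density A = 0 \<Longrightarrow> upper_density B = 0 \<Longrightarrow> upper_density (A \<union> B) = 0"
  by (metis add_0 antisym upper_density_Un_le upper_density_nonneg)

lemma upper_density_UN_eq_0:
  assumes "finite I" "\<And>i. i \<in> I \<Longrightarrow> upper_density (A i) = 0"
  shows "upper_density (\<Union>i\<in>I. A i) = 0"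
  using assms by (induction I) (auto intro: upper_density_Un_eq_0 upper_density_finite)

lemma card_le_if_separated:
  fixes A :: "nat set"
  assumes "k > 0" and separated: "\<And>a b. a \<in> A \<Longrightarrow> b \<in> A \<Longrightarrow> a < b \<Longrightarrow> a + k \<le> b"
  shows "card (A \<inter> {1..m}) \<le> m div k + 1"
proof -
  have "a div k \<noteq> b div k" if "a \<in> A" "b \<in> A" "a < b" for a b
    using div_le_mono[OF separated[OF that], of k] \<open>k > 0\<close> by simp
  then have "inj_on (\<lambda>a. a div k) (A \<inter> {1..m})"
    by (intro inj_onI) (metis IntD1 nat_neq_iff)
  moreover have "(\<lambda>a. a div k) ` (A \<inter> {1..m}) \<subseteq> {..m div k}"
    by (auto intro: div_le_mono)
  ultimately have "card (A \<inter> {1..m}) \<le> card {..m div k}"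
    by (intro card_inj_on_le) auto
  then show ?thesis by simp
qed

lemma upper_density_le_if_separated:
  assumes "k > 0" and "\<And>a b. a \<in> A \<Longrightarrow> b \<in> A \<Longrightarrow> a < b \<Longrightarrow> a + k \<le> b"
  shows "upper_density A \<le> ereal (1 / real k)"
proof (rule upper_density_le_if_tendsto)
  show "(\<lambda>m. 1 / real k + 1 / real m) \<longlonglongrightarrow> 1 / real k"
    using tendsto_add[OF tendsto_const lim_1_over_n] by simp
  show "real (card (A \<inter> {1..m})) / real m \<le> 1 / real k + 1 / real m" if "m > 0" for m
  proof -
    have "real (card (A \<inter> {1..m})) \<le> real (m div k) + 1"
      using card_le_if_separated[OF assms] by (metis of_nat_1 of_nat_add of_nat_le_iff)
    also have "\<dots> \<le> real m / real k + 1"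
      by (simp add: of_nat_div_le_of_nat)
    finally have "real (card (A \<inter> {1..m})) / real m \<le> (real m / real k + 1) / real m"
      by (rule divide_right_mono) simp
    then show ?thesis
      using \<open>m > 0\<close> by (simp add: add_divide_distrib)
  qed
qed

definition recurrence_set :: "nat set \<Rightarrow> nat \<Rightarrow> nat set" where
  "recurrence_set N k = {n \<in> N. n + k \<in> N}"

lemma recurrence_set_subset: "recurrence_set N k \<subseteq> N"
  by (auto simp: recurrence_set_def)

lemma upper_density_eq_0_if_recurrence_sets:
  assumes recurrence: "\<And>k. k > 0 \<Longrightarrow> upper_density (recurrence_set N k) = 0"
  shows "upper_density N = 0"
proof -
  have le_inverse: "upper_density N \<le> ereal (1 / real k)" if "k > 0" for k
  proof -
    define R where "R = (\<Union>i\<in>{1..<k}. recurrence_set N i)"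
    have "N = R \<union> (N - R)"
      using recurrence_set_subset by (auto simp: R_def)
    then have "upper_density N \<le> upper_density R + upper_density (N - R)"
      using upper_density_Un_le by metis
    also have "upper_density R = 0"
      unfolding R_def using recurrence by (intro upper_density_UN_eq_0) auto
    also have "0 + upper_density (N - R) \<le> ereal (1 / real k)"
      unfolding add_0
    proof (rule upper_density_le_if_separated[OF \<open>k > 0\<close>], rule ccontr)
      fix a b assume "a \<in> N - R" "b \<in> N - R" "a < b" "\<not> a + k \<le> b"
      then have "b - a \<in> {1..<k}" "a \<in> recurrence_set N (b - a)"
        by (auto simp: recurrence_set_def)
      with \<open>a \<in> N - R\<close> show False
        by (auto simp: R_def)
    qed
    finally show ?thesis .
  qed
  have "(\<lambda>k. ereal (1 / real k)) \<longlonglongrightarrow> ereal 0"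
    using lim_1_over_n by simp
  then have "upper_density N \<le> ereal 0"
    by (rule LIMSEQ_le_const) (use le_inverse in \<open>auto intro!: exI[of _ 1]\<close>)
  then show ?thesis
    using upper_density_nonneg[of N] by (simp flip: zero_ereal_def)
qed


section \<open>Arithmetic progressions up to density zero\<close>

definition progressions_up_to_density_zero :: "nat set \<Rightarrow> bool" where
  "progressions_up_to_density_zero N \<longleftrightarrow>
     (\<exists>\<A> Z. finite \<A> \<and> (\<forall>A\<in>\<A>. arithmetic_progression A) \<and> upper_density Z = 0 \<and>
        N = \<Union>\<A> \<union> Z)"

lemma progressions_up_to_density_zero_if_upper_density_eq_0:
  "upper_density N = 0 \<Longrightarrow> progressions_up_to_density_zero N"
  unfolding progressions_up_to_density_zero_def by (intro exI[of _ "{}"] exI[of _ N]) auto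

lemma progressions_up_to_density_zero_finite:
  "finite N \<Longrightarrow> progressions_up_to_density_zero N"
  by (intro progressions_up_to_density_zero_if_upper_density_eq_0 upper_density_finite)

lemma progressions_up_to_density_zero_arithmetic_progression:
  "arithmetic_progression N \<Longrightarrow> progressions_up_to_density_zero N"
  unfolding progressions_up_to_density_zero_def
  by (intro exI[of _ "{N}"] exI[of _ "{}"]) (auto intro: upper_density_finite)

lemma progressions_up_to_density_zero_Un:
  assumes "progressions_up_to_density_zero M" "progressions_up_to_density_zero N"
  shows "progressions_up_to_density_zero (M \<union> N)"
proof -
  obtain \<A> Z \<B> W where
    "finite \<A>" "\<forall>A\<in>\<A>. arithmetic_progression A" "upper_density Z = 0" "M = \<Union>\<A> \<union> Z"
    "finite \<B>" "\<forall>B\<in>\<B>. arithmetic_progression B" "upper_density W = 0" "N = \<Union>\<B> \<union> W"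
    using assms unfolding progressions_up_to_density_zero_def by metis
  then show ?thesis
    unfolding progressions_up_to_density_zero_def
    by (intro exI[of _ "\<A> \<union> \<B>"] exI[of _ "Z \<union> W"]) (auto intro: upper_density_Un_eq_0)
qed

lemma progressions_up_to_density_zero_UN:
  assumes "finite I" "\<And>i. i \<in> I \<Longrightarrow> progressions_up_to_density_zero (N i)"
  shows "progressions_up_to_density_zero (\<Union>i\<in>I. N i)"
  using assms
  by (induction I)
     (auto intro: progressions_up_to_density_zero_Un progressions_up_to_density_zero_finite)

lemma arithmetic_progression_residue_class:
  assumes "d > 0" and shift: "\<And>n. n \<in> N \<Longrightarrow> n + d \<in> N"
    and nonempty: "{n \<in> N. n mod d = r} \<noteq> {}"
  shows "arithmetic_progression {n \<in> N. n mod d = r}"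
proof -
  define a where "a = (LEAST n. n \<in> N \<and> n mod d = r)"
  have a: "a \<in> N" "a mod d = r"
    using LeastI_ex[of "\<lambda>n. n \<in> N \<and> n mod d = r"] nonempty by (auto simp: a_def)
  have "a + k * d \<in> N" for k
  proof (induction k)
    case (Suc k)
    then show ?case
      using shift[of "a + k * d"] by (simp add: algebra_simps)
  qed (use a in simp)
  moreover have "n \<in> range (\<lambda>k. a + k * d)" if "n \<in> N" "n mod d = r" for n
  proof -
    have "a \<le> n"
      unfolding a_def using that by (intro Least_le) simp
    moreover have "n mod d = a mod d"
      using that a by simp
    ultimately obtain k where "n = a + d * k"
      by (metis mod_eq_dvd_iff_nat dvdE le_add_diff_inverse)
    then show ?thesis
      by (auto simp: mult.commute)
  qed
  ultimately have "{n \<in> N. n mod d = r} = range (\<lambda>k. a + k * d)"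
    using a(2) by auto
  then show ?thesis
    unfolding arithmetic_progression_def using \<open>d > 0\<close> by blast
qed

lemma progressions_up_to_density_zero_if_shift_invariant:
  assumes "d > 0" and "\<And>n. n \<in> N \<Longrightarrow> n + d \<in> N"
  shows "progressions_up_to_density_zero N"
proof -
  have "progressions_up_to_density_zero {n \<in> N. n mod d = r}" for r
    using arithmetic_progression_residue_class[OF assms, of r]
      progressions_up_to_density_zero_arithmetic_progression progressions_up_to_density_zero_finite
    by (metis finite.emptyI)
  then have "progressions_up_to_density_zero (\<Union>r<d. {n \<in> N. n mod d = r})"
    by (intro progressions_up_to_density_zero_UN) auto
  also have "(\<Union>r<d. {n \<in> N. n mod d = r}) = N"
    using \<open>d > 0\<close> by auto
  finally show ?thesis .
qed

lemma subset_recurrence_sets_if_progression: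
  assumes "d > 0" and progression: "\<And>k. a + k * d \<in> N"
  shows "N \<subseteq> {..<a} \<union> (\<Union>e\<in>{1..d}. recurrence_set N e)"
proof
  fix n assume "n \<in> N"
  show "n \<in> {..<a} \<union> (\<Union>e\<in>{1..d}. recurrence_set N e)"
  proof (cases "n < a")
    case False
    define q r where "q = (n - a) div d" and "r = (n - a) mod d"
    have "n = a + (q * d + r)" "r < d"
      using False \<open>d > 0\<close> by (simp_all add: q_def r_def)
    then have "n + (d - r) = a + Suc q * d" "d - r \<in> {1..d}"
      by auto
    then have "n \<in> recurrence_set N (d - r)" "d - r \<in> {1..d}"
      using \<open>n \<in> N\<close> progression[of "Suc q"] by (simp_all add: recurrence_set_def)
    then show ?thesis by blast
  qed simp
qed

lemma progressions_up_to_density_zero_if_recurrence_sets: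
  assumes recurrence: "\<And>k. k > 0 \<Longrightarrow> progressions_up_to_density_zero (recurrence_set N k)"
  shows "progressions_up_to_density_zero N"
proof (cases "\<forall>k>0. upper_density (recurrence_set N k) = 0")
  case True
  then show ?thesis
    using upper_density_eq_0_if_recurrence_sets
      progressions_up_to_density_zero_if_upper_density_eq_0 by blast
next
  case False
  then obtain k where "k > 0" "upper_density (recurrence_set N k) \<noteq> 0"
    by blast
  moreover obtain \<A> Z where "\<forall>A\<in>\<A>. arithmetic_progression A" "upper_density Z = 0"
      "recurrence_set N k = \<Union>\<A> \<union> Z"
    using recurrence[OF \<open>k > 0\<close>] unfolding progressions_up_to_density_zero_def by blast
  ultimately obtain A where "A \<in> \<A>" "arithmetic_progression A"
    by (cases "\<A> = {}") auto
  moreover from \<open>A \<in> \<A>\<close> have "A \<subseteq> N"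
    using \<open>recurrence_set N k = \<Union>\<A> \<union> Z\<close> recurrence_set_subset by blast
  ultimately obtain a d where "d > 0" "\<And>j. a + j * d \<in> N"
    unfolding arithmetic_progression_def by blast
  then have cover: "N \<inter> {..<a} \<union> (\<Union>e\<in>{1..d}. recurrence_set N e) = N"
    using subset_recurrence_sets_if_progression recurrence_set_subset by blast
  have "progressions_up_to_density_zero (N \<inter> {..<a})"
    by (simp add: progressions_up_to_density_zero_finite)
  moreover have "progressions_up_to_density_zero (\<Union>e\<in>{1..d}. recurrence_set N e)"
    using recurrence by (intro progressions_up_to_density_zero_UN) auto
  ultimately have "progressions_up_to_density_zero
      (N \<inter> {..<a} \<union> (\<Union>e\<in>{1..d}. recurrence_set N e))"
    by (rule progressions_up_to_density_zero_Un)
  then show ?thesis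
    by (simp only: cover)
qed


section \<open>Return times in Noetherian spaces\<close>

definition noetherian_space :: "'a topology \<Rightarrow> bool" where
  "noetherian_space \<T> \<longleftrightarrow> wf {(A, B). closedin \<T> A \<and> closedin \<T> B \<and> A \<subset> B}"

lemma noetherian_space_subtopology:
  assumes "noetherian_space \<T>"
  shows "noetherian_space (subtopology \<T> S)"
proof -
  have eq_closure: "A = S \<inter> \<T> closure_of A" if "closedin (subtopology \<T> S) A" for A
    using closure_of_closedin[OF that] closedin_subset[OF that]
    by (auto simp: closure_of_subtopology inf_absorb2)
  have "\<T> closure_of A \<subset> \<T> closure_of B"
    if "closedin (subtopology \<T> S) A" "closedin (subtopology \<T> S) B" "A \<subset> B" for A B
  proof -
    have "\<T> closure_of A \<subseteq> \<T> closure_of B"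
      using that(3) by (intro closure_of_mono) auto
    then show ?thesis
      using eq_closure[OF that(1)] eq_closure[OF that(2)] that(3) by auto
  qed
  then have "{(A, B). closedin (subtopology \<T> S) A \<and> closedin (subtopology \<T> S) B \<and> A \<subset> B}
      \<subseteq> inv_image {(A, B). closedin \<T> A \<and> closedin \<T> B \<and> A \<subset> B} (\<lambda>A. \<T> closure_of A)"
    by (simp add: subset_iff)
  then show ?thesis
    unfolding noetherian_space_def
    by (rule wf_subset[OF wf_inv_image[OF assms[unfolded noetherian_space_def]]])
qed

definition return_times :: "('a \<Rightarrow> 'a) \<Rightarrow> 'a \<Rightarrow> 'a set \<Rightarrow> nat set" where
  "return_times f x C = {n. (f ^^ n) x \<in> C}"

lemma ex_closedin_shifted_return_times:
  assumes cont: "continuous_map (subtopology \<T> D) \<T> f"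
    and orbit: "\<And>n. (f ^^ n) x \<in> topspace \<T> \<inter> D"
    and "closedin \<T> C"
  shows "\<exists>B. closedin \<T> B \<and> (\<forall>n. n \<in> return_times f x B \<longleftrightarrow> n + k \<in> return_times f x C)"
proof (induction k)
  case 0
  with \<open>closedin \<T> C\<close> show ?case by auto
next
  case (Suc k)
  then obtain B where B: "closedin \<T> B"
      "\<And>n. n \<in> return_times f x B \<longleftrightarrow> n + k \<in> return_times f x C"
    by blast
  obtain B' where B': "closedin \<T> B'" "{z \<in> topspace (subtopology \<T> D). f z \<in> B} = B' \<inter> D"
    using closedin_continuous_map_preimage[OF cont B(1)] by (auto simp: closedin_subtopology)
  have "n \<in> return_times f x B' \<longleftrightarrow> n + Suc k \<in> return_times f x C" for n
  proof -
    have "(f ^^ n) x \<in> B' \<longleftrightarrow> f ((f ^^ n) x) \<in> B"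
      using orbit[of n] B'(2) by auto
    then show ?thesis
      using B(2)[of "Suc n"] by (simp add: return_times_def)
  qed
  with B'(1) show ?case by blast
qed

theorem return_times_noetherian_space:
  assumes "noetherian_space \<T>"
    and cont: "continuous_map (subtopology \<T> D) \<T> f"
    and orbit: "\<And>n. (f ^^ n) x \<in> topspace \<T> \<inter> D"
    and "closedin \<T> C"
  shows "progressions_up_to_density_zero (return_times f x C)"
  using \<open>closedin \<T> C\<close>
proof (induction C
    rule: wf_induct_rule[OF assms(1)[unfolded noetherian_space_def], case_names less])
  case (less C)
  define N where "N = return_times f x C"
  have "progressions_up_to_density_zero N"
  proof (cases "\<exists>d>0. \<forall>n\<in>N. n + d \<in> N")
    case True
    then show ?thesis
      using progressions_up_to_density_zero_if_shift_invariant by blast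
  next
    case False
    show ?thesis
    proof (rule progressions_up_to_density_zero_if_recurrence_sets)
      fix k :: nat assume "k > 0"
      obtain B where B: "closedin \<T> B" "\<And>n. n \<in> return_times f x B \<longleftrightarrow> n + k \<in> N"
        using ex_closedin_shifted_return_times[OF cont orbit less.prems] unfolding N_def by blast
      then have recurrence: "recurrence_set N k = return_times f x (C \<inter> B)"
        by (auto simp: recurrence_set_def N_def return_times_def)
      obtain n where "n \<in> N" "n + k \<notin> N"
        using False \<open>k > 0\<close> by blast
      then have "C \<inter> B \<subset> C"
        using B(2) by (auto simp: N_def return_times_def)
      moreover have "closedin \<T> (C \<inter> B)"
        using less.prems B(1) by (rule closedin_Int)
      ultimately show "progressions_up_to_density_zero (recurrence_set N k)"
        using less by (simp add: recurrence)
    qed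
  qed
  then show ?case
    by (simp add: N_def)
qed


section \<open>Hilbert's basis theorem\<close>

lemma ex_incseq_subseq:
  fixes a :: "nat \<Rightarrow> 'a::wellorder"
  shows "\<exists>s. strict_mono s \<and> incseq (\<lambda>k. a (s k))"
proof -
  have "\<exists>j>i. \<forall>k>i. a j \<le> a k" for i
  proof -
    define v where "v = (LEAST v. v \<in> a ` {i<..})"
    have "v \<in> a ` {i<..}"
      unfolding v_def by (rule LeastI[of _ "a (Suc i)"]) simp
    moreover have "v \<le> a k" if "k > i" for k
      unfolding v_def using that by (intro Least_le) simp
    ultimately show ?thesis by auto
  qed
  then obtain s where s: "\<And>n. s (Suc n) > s n \<and> (\<forall>k>s n. a (s (Suc n)) \<le> a k)"
    using dependent_nat_choice[of "\<lambda>_ _. True" "\<lambda>_ i j. j > i \<and> (\<forall>k>i. a j \<le> a k)"] by blast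
  then have "strict_mono s"
    by (simp add: strict_mono_Suc_iff)
  moreover have "incseq (\<lambda>k. a (s (Suc k)))"
    using s by (intro incseq_SucI) (meson less_trans)
  ultimately show ?thesis
    by (intro exI[of _ "\<lambda>k. s (Suc k)"]) (simp add: strict_mono_Suc_iff)
qed

lemma ex_incseq_subseq_finite:
  fixes a :: "nat \<Rightarrow> 'i \<Rightarrow> 'a::wellorder"
  assumes "finite I"
  shows "\<exists>s. strict_mono s \<and> (\<forall>i\<in>I. incseq (\<lambda>k. a (s k) i))"
  using assms
proof (induction I)
  case empty
  then show ?case by (auto intro: strict_mono_id)
next
  case (insert i I)
  then obtain s where s: "strict_mono s" "\<forall>j\<in>I. incseq (\<lambda>k. a (s k) j)"
    by blast
  obtain t where t: "strict_mono t" "incseq (\<lambda>k. a (s (t k)) i)"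
    using ex_incseq_subseq[of "\<lambda>k. a (s k) i"] by blast
  have "incseq (\<lambda>k. a (s (t k)) j)" if "j \<in> I" for j
    using s(2) t(1) that by (simp add: incseq_def strict_mono_less_eq)
  moreover have "strict_mono (\<lambda>k. s (t k))"
    using s(1) t(1) by (simp add: strict_mono_def)
  ultimately show ?case
    using t(2) by (intro exI[of _ "\<lambda>k. s (t k)"]) auto
qed

lemma Dickson_monomials:
  fixes m :: "nat \<Rightarrow> ('n::finite \<Rightarrow>\<^sub>0 nat)"
  obtains i j t where "i < j" "m j = t + m i"
proof -
  obtain s where s: "strict_mono s" "\<And>i. incseq (\<lambda>k. Poly_Mapping.lookup (m (s k)) i)"
    using ex_incseq_subseq_finite[of UNIV "\<lambda>k. Poly_Mapping.lookup (m k)"] by auto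
  have "m (s 1) = (m (s 1) - m (s 0)) + m (s 0)"
    by (rule poly_mapping_eqI) (use s(2) in \<open>simp add: lookup_add lookup_minus incseq_def\<close>)
  moreover have "s 0 < s 1"
    using s(1) by (simp add: strict_mono_def)
  ultimately show ?thesis
    using that by blast
qed

locale monomial_code =
  fixes code :: "('n::finite \<Rightarrow>\<^sub>0 nat) \<Rightarrow> nat"
  assumes inj_code: "inj code"
    and code_add: "code (a + b) = code a * code b"
begin

definition lead_monomial :: "(('n \<Rightarrow>\<^sub>0 nat) \<Rightarrow>\<^sub>0 'a::zero) \<Rightarrow> ('n \<Rightarrow>\<^sub>0 nat)" where
  "lead_monomial p = (ARG_MAX code m. m \<in> Poly_Mapping.keys p)"

lemma
  assumes "p \<noteq> 0"
  shows lead_monomial_in_keys: "lead_monomial p \<in> Poly_Mapping.keys p"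
    and code_le_lead_monomial:
      "m \<in> Poly_Mapping.keys p \<Longrightarrow> code m \<le> code (lead_monomial p)"
proof -
  obtain k where "k \<in> Poly_Mapping.keys p"
    using assms by fastforce
  moreover have "\<forall>m. m \<in> Poly_Mapping.keys p \<longrightarrow> code m < Suc (Max (code ` Poly_Mapping.keys p))"
    by (simp add: le_imp_less_Suc)
  ultimately show "lead_monomial p \<in> Poly_Mapping.keys p"
      "m \<in> Poly_Mapping.keys p \<Longrightarrow> code m \<le> code (lead_monomial p)"
    using arg_max_nat_lemma[of "\<lambda>m. m \<in> Poly_Mapping.keys p"] unfolding lead_monomial_def by blast+
qed

lemma ex_minimal_lead_monomial:
  assumes "A \<noteq> {}"
  shows "\<exists>q\<in>A. \<forall>r\<in>A. code (lead_monomial q) \<le> code (lead_monomial r)"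
proof -
  obtain p where "p \<in> A"
    using assms by blast
  then show ?thesis
    unfolding Bex_def Ball_def by (rule ex_has_least_nat)
qed

definition reduce_lead ::
  "('n \<Rightarrow>\<^sub>0 nat) \<Rightarrow> (('n \<Rightarrow>\<^sub>0 nat) \<Rightarrow>\<^sub>0 'a::field) \<Rightarrow>
     (('n \<Rightarrow>\<^sub>0 nat) \<Rightarrow>\<^sub>0 'a) \<Rightarrow> (('n \<Rightarrow>\<^sub>0 nat) \<Rightarrow>\<^sub>0 'a)"
where
  "reduce_lead t p q = q - Poly_Mapping.single t
     (Poly_Mapping.lookup q (lead_monomial q) / Poly_Mapping.lookup p (lead_monomial p)) * p"

lemma code_lead_monomial_reduce_lead:
  assumes "p \<noteq> 0" "q \<noteq> 0" and multiple: "lead_monomial q = t + lead_monomial p"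
    and nonzero: "reduce_lead t p q \<noteq> 0"
  shows "code (lead_monomial (reduce_lead t p q)) < code (lead_monomial q)"
proof -
  define c where
    "c = Poly_Mapping.lookup q (lead_monomial q) / Poly_Mapping.lookup p (lead_monomial p)"
  define r where "r = reduce_lead t p q"
  have r: "r = q - Poly_Mapping.single t c * p"
    by (simp add: r_def reduce_lead_def c_def)
  have code_le: "code m \<le> code (lead_monomial q)" if m: "m \<in> Poly_Mapping.keys r" for m
  proof (cases "m \<in> Poly_Mapping.keys q")
    case True
    then show ?thesis
      by (rule code_le_lead_monomial[OF \<open>q \<noteq> 0\<close>])
  next
    case False
    then have "m \<in> Poly_Mapping.keys (Poly_Mapping.single t c * p)"
      using m keys_diff[of q "Poly_Mapping.single t c * p"] unfolding r by blast
    then obtain l where "m = t + l" "l \<in> Poly_Mapping.keys p"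
      using keys_mult[of "Poly_Mapping.single t c" p] by (auto split: if_splits)
    then show ?thesis
      using code_le_lead_monomial[OF \<open>p \<noteq> 0\<close>, of l] by (simp add: multiple code_add)
  qed
  have "Poly_Mapping.lookup (Poly_Mapping.single t c * p) (lead_monomial q) =
      c * Poly_Mapping.lookup p (lead_monomial p)"
    by (simp add: multiple lookup_mult lookup_single when_mult)
  then have "Poly_Mapping.lookup r (lead_monomial q) = 0"
    using lead_monomial_in_keys[OF \<open>p \<noteq> 0\<close>]
    by (simp add: r lookup_minus c_def in_keys_iff)
  then have "lead_monomial r \<noteq> lead_monomial q"
    using lead_monomial_in_keys[OF nonzero, folded r_def] by (auto simp: in_keys_iff)
  then show ?thesis
    using code_le[OF lead_monomial_in_keys[OF nonzero, folded r_def]] inj_code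
    unfolding r_def by (metis inj_eq order_le_less)
qed

end

text \<open>Sending the variables to distinct primes embeds the monomials into the natural numbers, which
  yields a well-order compatible with multiplication.\<close>

definition prime_code :: "('n \<Rightarrow> nat) \<Rightarrow> ('n::finite \<Rightarrow>\<^sub>0 nat) \<Rightarrow> nat" where
  "prime_code P m = (\<Prod>i\<in>UNIV. P i ^ Poly_Mapping.lookup m i)"

lemma multiplicity_prime_code:
  assumes "inj P" and prime: "\<And>i. normalization_semidom_class.prime (P i)"
  shows "multiplicity (P i) (prime_code P m) = Poly_Mapping.lookup m i"
proof -
  define e where "e = Poly_Mapping.lookup m \<circ> the_inv P"
  have "prime_code P m = (\<Prod>p\<in>range P. p ^ e p)"
    unfolding prime_code_def e_def
    by (simp add: prod.reindex[OF \<open>inj P\<close>] the_inv_f_f[OF \<open>inj P\<close>])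
  then have "multiplicity (P i) (prime_code P m) = e (P i)"
    using multiplicity_prod_prime_powers[of "range P" "P i" e] prime by auto
  then show ?thesis
    by (simp add: e_def the_inv_f_f[OF \<open>inj P\<close>])
qed

lemma ex_monomial_code: "\<exists>code :: ('n::finite \<Rightarrow>\<^sub>0 nat) \<Rightarrow> nat. monomial_code code"
proof -
  obtain Q :: "nat set" where "finite Q" "card Q = CARD('n)"
      "Q \<subseteq> {p. normalization_semidom_class.prime p}"
    using infinite_arbitrarily_large[OF primes_infinite] by blast
  moreover from this obtain P :: "'n \<Rightarrow> nat" where "bij_betw P UNIV Q"
    by (metis finite finite_same_card_bij)
  ultimately have P: "inj P" "\<And>i. normalization_semidom_class.prime (P i)"
    by (auto simp: bij_betw_def)
  have "monomial_code (prime_code P)"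
  proof
    show "inj (prime_code P)"
      by (rule injI, rule poly_mapping_eqI) (metis multiplicity_prime_code[OF P])
    show "prime_code P (a + b) = prime_code P a * prime_code P b" for a b
      by (simp add: prime_code_def lookup_add power_add prod.distrib)
  qed
  then show ?thesis by blast
qed

text \<open>The ideals of a commutative ring are its submodules as a module over itself.\<close>

interpretation regular_module: Modules.module "(*) :: 'a::comm_ring_1 \<Rightarrow> 'a \<Rightarrow> 'a"
  by standard (simp_all add: algebra_simps)

lemma (in monomial_code) lead_monomial_not_multiple_if_minimal:
  fixes I J :: "(('n \<Rightarrow>\<^sub>0 nat) \<Rightarrow>\<^sub>0 'a::field) set"
  assumes I: "regular_module.subspace I" and J: "regular_module.subspace J" "I \<subseteq> J"
    and q: "q \<in> J - I"
    and minimal: "\<And>r. r \<in> J - I \<Longrightarrow> code (lead_monomial q) \<le> code (lead_monomial r)"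
    and p: "p \<in> I" "p \<noteq> 0"
  shows "lead_monomial q \<noteq> t + lead_monomial p"
proof
  assume multiple: "lead_monomial q = t + lead_monomial p"
  define r where "r = reduce_lead t p q"
  have diff: "q - r \<in> I"
    by (simp add: r_def reduce_lead_def regular_module.subspace_scale[OF I p(1)])
  have "r \<in> J - I"
  proof
    show "r \<in> J"
      using regular_module.subspace_diff[OF J(1), of q "q - r"] J(2) q diff by auto
    show "r \<notin> I"
      using regular_module.subspace_add[OF I _ diff, of r] q by auto
  qed
  moreover from this have "r \<noteq> 0" "q \<noteq> 0"
    using regular_module.subspace_0[OF I] q by auto
  ultimately show False
    using code_lead_monomial_reduce_lead[OF p(2) _ multiple] minimal[of r] by (simp add: r_def)
qed

theorem wf_supset_ideals:
  "wf {(J, I :: (('n::finite \<Rightarrow>\<^sub>0 nat) \<Rightarrow>\<^sub>0 'a::field) set).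
     regular_module.subspace I \<and> regular_module.subspace J \<and> I \<subset> J}"
  unfolding wf_iff_no_infinite_down_chain
proof
  assume "\<exists>I. \<forall>n. (I (Suc n), I n :: (('n \<Rightarrow>\<^sub>0 nat) \<Rightarrow>\<^sub>0 'a) set) \<in>
    {(J, I). regular_module.subspace I \<and> regular_module.subspace J \<and> I \<subset> J}"
  then obtain I :: "nat \<Rightarrow> (('n \<Rightarrow>\<^sub>0 nat) \<Rightarrow>\<^sub>0 'a) set"
    where chain: "\<And>n. regular_module.subspace (I n) \<and> regular_module.subspace (I (Suc n)) \<and>
      I n \<subset> I (Suc n)"
    by auto
  then have ideal: "\<And>n. regular_module.subspace (I n)" and strict: "\<And>n. I n \<subset> I (Suc n)"
    by simp_all
  obtain code :: "('n \<Rightarrow>\<^sub>0 nat) \<Rightarrow> nat" where "monomial_code code"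
    using ex_monomial_code by blast
  then interpret monomial_code code .
  have "\<exists>q\<in>I (Suc n) - I n. \<forall>r\<in>I (Suc n) - I n.
      code (lead_monomial q) \<le> code (lead_monomial r)" for n
    by (rule ex_minimal_lead_monomial) (use strict[of n] in blast)
  then obtain q where q: "\<And>n. q n \<in> I (Suc n) - I n" and minimal:
      "\<And>n r. r \<in> I (Suc n) - I n \<Longrightarrow> code (lead_monomial (q n)) \<le> code (lead_monomial r)"
    by metis
  obtain i j t where "i < j" and multiple: "lead_monomial (q j) = t + lead_monomial (q i)"
    using Dickson_monomials[of "\<lambda>n. lead_monomial (q n)"] .
  have "I (Suc i) \<subseteq> I j"
    by (rule lift_Suc_mono_le[of I, OF psubset_imp_subset[OF strict]]) (use \<open>i < j\<close> in simp)
  then have "q i \<in> I j"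
    using q[of i] by blast
  moreover have "q i \<noteq> 0"
    using q[of i] regular_module.subspace_0[OF ideal[of i]] by auto
  ultimately have "lead_monomial (q j) \<noteq> t + lead_monomial (q i)"
    by (intro lead_monomial_not_multiple_if_minimal[OF ideal ideal psubset_imp_subset[OF strict] q]
        minimal)
  then show False
    using multiple by contradiction
qed


section \<open>The Zariski topology is Noetherian\<close>

definition vanishing_ideal :: "'n::finite proj_space set \<Rightarrow> 'n mpolynomial set" where
  "vanishing_ideal C = {p. \<forall>P\<in>C. \<forall>v\<in>hom_coords P. peval p v = 0}"

lemma subspace_vanishing_ideal: "regular_module.subspace (vanishing_ideal C)"
  by (rule regular_module.subspaceI) (auto simp: vanishing_ideal_def peval_add peval_mult)

lemma zero_locus_vanishing_ideal:
  assumes "algebraic_set C"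
  shows "zero_locus (vanishing_ideal C) = C"
  using assms by (auto simp: algebraic_set_def zero_locus_def vanishing_ideal_def)

theorem noetherian_space_zariski: "noetherian_space zariski"
proof -
  have "vanishing_ideal D \<subset> vanishing_ideal C"
    if "algebraic_set C" "algebraic_set D" "C \<subset> D" for C D :: "'a proj_space set"
  proof
    show "vanishing_ideal D \<subseteq> vanishing_ideal C"
      using that(3) by (auto simp: vanishing_ideal_def)
    show "vanishing_ideal D \<noteq> vanishing_ideal C"
      using that zero_locus_vanishing_ideal by (metis less_irrefl)
  qed
  then have "{(C, D). algebraic_set C \<and> algebraic_set D \<and> C \<subset> (D :: 'a proj_space set)} \<subseteq>
      inv_image {(J, I). regular_module.subspace I \<and> regular_module.subspace J \<and> I \<subset> J}
        vanishing_ideal"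
    by (simp add: subset_iff subspace_vanishing_ideal)
  then show ?thesis
    unfolding noetherian_space_def closedin_zariski
    by (rule wf_subset[OF wf_inv_image[OF wf_supset_ideals]])
qed


section \<open>Regular functions\<close>

lemma openin_subtopology_trans:
  assumes "openin (subtopology \<T> V) W" "openin (subtopology \<T> S) V"
  shows "openin (subtopology \<T> S) W"
proof -
  have "V \<subseteq> S"
    using openin_subset[OF assms(2)] by simp
  then have "openin (subtopology (subtopology \<T> S) V) W"
    using assms(1) by (simp add: subtopology_subtopology inf_absorb2)
  then show ?thesis
    using assms(2) by (rule openin_trans_full)
qed

lemma peval_diff: "peval (p - q) v = peval p v - peval q v"
  using peval_add[of "p - q" q v] by (simp add: algebra_simps)

lemma homogeneous_diff:
  assumes "homogeneous d p" "homogeneous d q"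
  shows "homogeneous d (p - q)"
  using assms keys_diff[of p q] unfolding homogeneous_def by blast

definition nonvanishing_locus :: "'n::finite mpolynomial \<Rightarrow> 'n proj_space set" where
  "nonvanishing_locus p = {P. \<forall>v\<in>hom_coords P. peval p v \<noteq> 0}"

lemma nonvanishing_locusI:
  assumes "homogeneous d p" "v \<in> hom_coords P" "peval p v \<noteq> 0"
  shows "P \<in> nonvanishing_locus p"
proof -
  have "peval p w \<noteq> 0" if "w \<in> hom_coords P" for w
    using peval_zero_hom_coords[OF assms(1) that assms(2)] assms(3) by blast
  then show ?thesis
    by (simp add: nonvanishing_locus_def)
qed

lemma openin_nonvanishing_locus:
  assumes "homogeneous d p"
  shows "openin zariski (nonvanishing_locus p)"
proof -
  have "P \<in> - nonvanishing_locus p \<longleftrightarrow> P \<in> zero_locus {p}" for P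
    using nonvanishing_locusI[OF assms, of _ P] hom_coords_nonempty[of P]
    by (auto simp: zero_locus_def nonvanishing_locus_def)
  then have "- nonvanishing_locus p = zero_locus {p}"
    by blast
  then show ?thesis
    unfolding openin_zariski algebraic_set_def using assms by blast
qed

definition fraction_on ::
  "'n::finite proj_space set \<Rightarrow> nat \<Rightarrow> 'n mpolynomial \<Rightarrow> 'n mpolynomial \<Rightarrow>
     ('n proj_space \<Rightarrow> qbar) \<Rightarrow> bool"
where
  "fraction_on W d p q f \<longleftrightarrow> homogeneous d p \<and> homogeneous d q \<and>
     (\<forall>P\<in>W. \<forall>v\<in>hom_coords P. peval q v \<noteq> 0 \<and> f P = peval p v / peval q v)"

lemma fraction_on_subset: "fraction_on W d p q f \<Longrightarrow> U \<subseteq> W \<Longrightarrow> fraction_on U d p q f"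
  unfolding fraction_on_def by blast

lemma fraction_on_diff:
  assumes "fraction_on W d p q f" "fraction_on W d' p' q' g"
  shows "fraction_on W (d + d') (p * q' - q * p') (q * q') (\<lambda>P. f P - g P)"
proof -
  have "homogeneous (d + d') (p * q' - q * p')" "homogeneous (d + d') (q * q')"
    using assms by (simp_all add: fraction_on_def homogeneous_diff homogeneous_mult)
  moreover have "peval (q * q') v \<noteq> 0 \<and> f P - g P = peval (p * q' - q * p') v / peval (q * q') v"
    if "P \<in> W" "v \<in> hom_coords P" for P v
    using assms that by (simp add: fraction_on_def peval_diff peval_mult diff_frac_eq mult.commute)
  ultimately show ?thesis
    unfolding fraction_on_def by blast
qed

lemma openin_fraction_nonzero:
  assumes "openin (zariski_on V) W" "fraction_on W d p q f"
  shows "openin (zariski_on V) {P \<in> W. f P \<noteq> 0}"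
proof -
  have "homogeneous d p"
    using assms(2) by (simp add: fraction_on_def)
  then have "openin (zariski_on V) (W \<inter> (V \<inter> nonvanishing_locus p))"
    using assms(1) by (intro openin_Int openin_subtopology_Int2 openin_nonvanishing_locus)
  moreover have "P \<in> nonvanishing_locus p \<longleftrightarrow> f P \<noteq> 0" if "P \<in> W" for P
  proof -
    have "f P \<noteq> 0 \<longleftrightarrow> peval p v \<noteq> 0" if "v \<in> hom_coords P" for v
      using assms(2) that \<open>P \<in> W\<close> by (simp add: fraction_on_def)
    then show ?thesis
      unfolding nonvanishing_locus_def using hom_coords_nonempty[of P] by blast
  qed
  then have "W \<inter> (V \<inter> nonvanishing_locus p) = {P \<in> W. f P \<noteq> 0}"
    using openin_subset[OF assms(1)] by auto
  ultimately show ?thesis by simp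
qed

lemma regular_function_iff_fraction_on:
  "regular_function V f \<longleftrightarrow>
     (\<forall>P\<in>V. \<exists>W p q d. openin (zariski_on V) W \<and> P \<in> W \<and> fraction_on W d p q f)"
  unfolding regular_function_def fraction_on_def by (rule refl)

lemma regular_functionE:
  assumes "regular_function V f" "P \<in> V"
  obtains W d p q where "openin (zariski_on V) W" "P \<in> W" "fraction_on W d p q f"
  using assms unfolding regular_function_iff_fraction_on by meson

lemma regular_function_subset:
  assumes "regular_function V f" "U \<subseteq> V"
  shows "regular_function U f"
  unfolding regular_function_iff_fraction_on
proof
  fix P assume "P \<in> U"
  with assms(2) have "P \<in> V"
    by blast
  obtain W d p q where W: "openin (zariski_on V) W" "P \<in> W" "fraction_on W d p q f"
    using regular_functionE[OF assms(1) \<open>P \<in> V\<close>] .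
  have "openin (zariski_on U) (W \<inter> U)"
    using W(1) assms(2) by (auto simp: openin_subtopology)
  moreover have "fraction_on (W \<inter> U) d p q f"
    using W(3) by (rule fraction_on_subset) simp
  ultimately show "\<exists>W p q d. openin (zariski_on U) W \<and> P \<in> W \<and> fraction_on W d p q f"
    using W(2) \<open>P \<in> U\<close> by blast
qed

lemma regular_function_diff:
  assumes "regular_function V f" "regular_function V g"
  shows "regular_function V (\<lambda>P. f P - g P)"
  unfolding regular_function_iff_fraction_on
proof
  fix P assume "P \<in> V"
  obtain W d p q where W: "openin (zariski_on V) W" "P \<in> W" "fraction_on W d p q f"
    using regular_functionE[OF assms(1) \<open>P \<in> V\<close>] .
  obtain W' d' p' q' where
    W': "openin (zariski_on V) W'" "P \<in> W'" "fraction_on W' d' p' q' g"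
    using regular_functionE[OF assms(2) \<open>P \<in> V\<close>] .
  have "fraction_on (W \<inter> W') (d + d') (p * q' - q * p') (q * q') (\<lambda>P. f P - g P)"
    by (rule fraction_on_diff[OF fraction_on_subset[OF W(3)] fraction_on_subset[OF W'(3)]]) auto
  then show "\<exists>W p q d. openin (zariski_on V) W \<and> P \<in> W \<and> fraction_on W d p q (\<lambda>P. f P - g P)"
    using openin_Int[OF W(1) W'(1)] W(2) W'(2) by blast
qed

lemma openin_regular_function_nonzero:
  assumes "regular_function V f"
  shows "openin (zariski_on V) {P \<in> V. f P \<noteq> 0}"
  unfolding openin_subopen[of _ "{P \<in> V. f P \<noteq> 0}"]
proof
  fix P assume P: "P \<in> {P \<in> V. f P \<noteq> 0}"
  then obtain W d p q where W: "openin (zariski_on V) W" "P \<in> W" "fraction_on W d p q f"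
    using regular_functionE[OF assms, of P] by blast
  have "openin (zariski_on V) {Q \<in> W. f Q \<noteq> 0}"
    using W(1,3) by (rule openin_fraction_nonzero)
  moreover have "W \<subseteq> V"
    using openin_subset[OF W(1)] by simp
  ultimately show "\<exists>U. openin (zariski_on V) U \<and> P \<in> U \<and> U \<subseteq> {P \<in> V. f P \<noteq> 0}"
    using P W(2) by blast
qed

lemma regular_functions_eq_if_eq_on_dense:
  assumes V: "openin (zariski_on \<X>) V"
    and "regular_function V f" "regular_function V g"
    and dense: "zariski_on \<X> closure_of W = \<X>"
    and eq: "\<And>Q. Q \<in> W \<inter> V \<Longrightarrow> f Q = g Q"
    and "P \<in> V"
  shows "f P = g P"
proof -
  define N where "N = {Q \<in> V. f Q - g Q \<noteq> 0}"
  have N: "openin (zariski_on \<X>) N"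
    unfolding N_def using assms(2,3)
    by (intro openin_subtopology_trans[OF _ V] openin_regular_function_nonzero
        regular_function_diff)
  have "N \<inter> W = {}"
    using eq by (auto simp: N_def)
  then have "N \<inter> \<X> = {}"
    using openin_Int_closure_of_eq_empty[OF N, of W] dense by simp
  moreover have "N \<subseteq> \<X>"
    using openin_subset[OF N] by simp
  ultimately show ?thesis
    using \<open>P \<in> V\<close> by (auto simp: N_def)
qed


section \<open>Affine charts\<close>

lemma line_of_hom_coords:
  assumes "v \<in> hom_coords P"
  shows "line_of P = range (\<lambda>c. c *s v)"
proof -
  obtain u where u: "line_of P = range (\<lambda>c. c *s u)"
    using line_of[of P] by auto
  obtain a where a: "v = a *s u" "a \<noteq> 0"
    using assms u by (auto simp: hom_coords_def)
  have "c *s u = (c / a) *s v" "c *s v = (c * a) *s u" for c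
    using a by (simp_all add: vector_smult_assoc)
  then show ?thesis
    unfolding u by (intro equalityI image_subsetI) (metis rangeI)+
qed

lemma proj_space_eqI:
  assumes "v \<in> hom_coords P" "c *s v \<in> hom_coords Q"
  shows "P = Q"
proof -
  have "c \<noteq> 0"
    using assms(2) by (auto simp: hom_coords_def)
  moreover have "c *s v \<in> line_of P"
    using line_of_hom_coords[OF assms(1)] by blast
  ultimately have "c *s v \<in> hom_coords P"
    using assms(1) by (simp add: hom_coords_def)
  then show ?thesis
    using line_of_hom_coords assms(2) by (metis line_of_inject)
qed

definition hom_quotient :: "'n::finite mpolynomial \<Rightarrow> 'n mpolynomial \<Rightarrow> 'n proj_space \<Rightarrow> qbar" where
  "hom_quotient p q P = (let v = SOME v. v \<in> hom_coords P in peval p v / peval q v)"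

lemma hom_quotient_eq:
  assumes "homogeneous d p" "homogeneous d q" "v \<in> hom_coords P"
  shows "hom_quotient p q P = peval p v / peval q v"
proof -
  have "(SOME v. v \<in> hom_coords P) \<in> hom_coords P"
    using hom_coords_nonempty by (rule someI_ex)
  then obtain c where "c \<noteq> 0" "(SOME v. v \<in> hom_coords P) = c *s v"
    using hom_coordsE[OF assms(3)] by blast
  then show ?thesis
    by (simp add: hom_quotient_def peval_scale[OF assms(1)] peval_scale[OF assms(2)])
qed

lemma regular_function_hom_quotient:
  assumes "homogeneous d p" "homogeneous d q" "V \<subseteq> nonvanishing_locus q"
  shows "regular_function V (hom_quotient p q)"
proof -
  have "fraction_on V d p q (hom_quotient p q)"
    using assms hom_quotient_eq[OF assms(1,2)]
    by (auto simp: fraction_on_def nonvanishing_locus_def)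
  moreover have "openin (zariski_on V) V"
    using openin_topspace[of "zariski_on V"] by simp
  ultimately show ?thesis
    unfolding regular_function_iff_fraction_on by blast
qed

definition coord_poly :: "'n \<Rightarrow> 'n::finite mpolynomial" where
  "coord_poly i = Poly_Mapping.single (Poly_Mapping.single i 1) 1"

lemma peval_coord_poly [simp]: "peval (coord_poly i) v = v $ i"
proof -
  have "(\<Prod>j\<in>UNIV. v $ j ^ Poly_Mapping.lookup (Poly_Mapping.single i (1::nat)) j) =
      (\<Prod>j\<in>UNIV. if j = i then v $ j else 1)"
    by (intro prod.cong) (auto simp: lookup_single when_def)
  then show ?thesis
    by (simp add: coord_poly_def peval_single)
qed

lemma homogeneous_coord_poly: "homogeneous 1 (coord_poly i)"
  by (simp add: homogeneous_def coord_poly_def lookup_single when_def)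

lemma proj_space_eqI_chart:
  assumes l: "homogeneous 1 l" "P \<in> nonvanishing_locus l" "Q \<in> nonvanishing_locus l"
    and coords: "\<And>i. hom_quotient (coord_poly i) l P = hom_quotient (coord_poly i) l Q"
  shows "P = Q"
proof -
  obtain v w where vw: "v \<in> hom_coords P" "w \<in> hom_coords Q"
    using hom_coords_nonempty by metis
  then have nonzero: "peval l v \<noteq> 0" "peval l w \<noteq> 0"
    using l(2,3) by (auto simp: nonvanishing_locus_def)
  have "v $ i / peval l v = w $ i / peval l w" for i
    using coords[of i] hom_quotient_eq[OF homogeneous_coord_poly l(1)] vw by simp
  then have "w $ i = (peval l w / peval l v) * v $ i" for i
    using nonzero by (simp add: field_simps)
  moreover define c where "c = peval l w / peval l v"
  ultimately have "w = c *s v"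
    by (simp add: vec_eq_iff)
  then show ?thesis
    using vw by (intro proj_space_eqI[of v P c Q]) simp_all
qed

lemma ex_common_chart:
  fixes P Q :: "'n::finite proj_space"
  obtains l where "homogeneous 1 l" "P \<in> nonvanishing_locus l" "Q \<in> nonvanishing_locus l"
proof -
  obtain v w where vw: "v \<in> hom_coords P" "w \<in> hom_coords Q"
    using hom_coords_nonempty by metis
  then obtain i j where ij: "v $ i \<noteq> 0" "w $ j \<noteq> 0"
    by (auto simp: hom_coords_def vec_eq_iff)
  let ?L = "{coord_poly i, coord_poly j, coord_poly i - coord_poly j}"
  have "\<exists>l\<in>?L. peval l v \<noteq> 0 \<and> peval l w \<noteq> 0"
    using ij by (auto simp: peval_diff)
  moreover have "\<forall>l\<in>?L. homogeneous 1 l"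
    using homogeneous_coord_poly homogeneous_diff by blast
  ultimately obtain l where "homogeneous 1 l" "peval l v \<noteq> 0" "peval l w \<noteq> 0"
    by blast
  then show ?thesis
    using that nonvanishing_locusI vw by blast
qed


section \<open>Morphisms and rational maps\<close>

lemma morphism_in: "morphism \<X> \<Y> f \<Longrightarrow> P \<in> \<X> \<Longrightarrow> f P \<in> \<Y>"
  by (auto simp: morphism_def continuous_map_def Pi_iff)

lemma openin_morphism_preimage:
  assumes "openin (zariski_on \<X>) U" "morphism U \<Y> f" "openin (zariski_on \<Y>) N"
  shows "openin (zariski_on \<X>) {P \<in> U. f P \<in> N}"
proof -
  have "openin (zariski_on U) {P \<in> topspace (zariski_on U). f P \<in> N}"
    using assms(2,3) openin_continuous_map_preimage unfolding morphism_def by blast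
  then show ?thesis
    using openin_subtopology_trans[OF _ assms(1)] by simp
qed

text \<open>This is the separatedness of projective space: two values of a pair of morphisms lie in a
  common affine chart, whose coordinate functions are regular and separate points.\<close>

lemma morphisms_eq_if_eq_on_dense:
  assumes open_domains: "openin (zariski_on \<X>) U" "openin (zariski_on \<X>) V"
    and morphism_fg: "morphism U \<Y> f" "morphism V \<Y> g"
    and dense: "zariski_on \<X> closure_of W = \<X>" and eq: "\<And>Q. Q \<in> W \<Longrightarrow> f Q = g Q"
    and P: "P \<in> U" "P \<in> V"
  shows "f P = g P"
proof -
  obtain l where l: "homogeneous 1 l" "f P \<in> nonvanishing_locus l" "g P \<in> nonvanishing_locus l"
    using ex_common_chart .
  define N where "N = \<Y> \<inter> nonvanishing_locus l"
  have N: "openin (zariski_on \<Y>) N"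
    unfolding N_def using openin_nonvanishing_locus[OF l(1)] by (rule openin_subtopology_Int2)
  define E where "E = {Q \<in> U. f Q \<in> N} \<inter> {Q \<in> V. g Q \<in> N}"
  have E: "openin (zariski_on \<X>) E"
    unfolding E_def using open_domains morphism_fg N
    by (intro openin_Int openin_morphism_preimage)
  have "P \<in> E"
    using P l(2,3) morphism_fg by (simp add: E_def N_def morphism_in)
  have "hom_quotient (coord_poly i) l (f P) = hom_quotient (coord_poly i) l (g P)" for i
  proof -
    define h where "h = hom_quotient (coord_poly i) l"
    have "regular_function N h"
      unfolding h_def using homogeneous_coord_poly l(1)
      by (rule regular_function_hom_quotient) (simp add: N_def)
    then have "regular_function {Q \<in> U. f Q \<in> N} (h \<circ> f)"
        "regular_function {Q \<in> V. g Q \<in> N} (h \<circ> g)"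
      using morphism_fg N unfolding morphism_def by blast+
    then have "regular_function E (h \<circ> f)" "regular_function E (h \<circ> g)"
      by (auto simp: E_def intro: regular_function_subset)
    then have "(h \<circ> f) P = (h \<circ> g) P"
      by (rule regular_functions_eq_if_eq_on_dense[OF E _ _ dense]) (use eq \<open>P \<in> E\<close> in auto)
    then show ?thesis
      by (simp add: h_def)
  qed
  then show ?thesis
    by (rule proj_space_eqI_chart[OF l])
qed

lemma rational_mapsD:
  assumes "\<Phi> \<in> rational_maps \<X> \<Y>" "(U, f) \<in> \<Phi>"
  shows "openin (zariski_on \<X>) U" "morphism U \<Y> f"
proof -
  have "(U, f) \<in> partial_morphisms \<X> \<Y>"
    using assms in_quotient_imp_subset[OF equiv_rational_equiv] unfolding rational_maps_def by blast
  then show "openin (zariski_on \<X>) U" "morphism U \<Y> f"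
    by (auto simp: partial_morphisms_def dense_open_def)
qed

lemma rational_maps_representatives_eq:
  assumes \<Phi>: "\<Phi> \<in> rational_maps \<X> \<Y>" and f: "(U, f) \<in> \<Phi>" "P \<in> U" and g: "(V, g) \<in> \<Phi>" "P \<in> V"
  shows "f P = g P"
proof -
  have "((U, f), (V, g)) \<in> rational_equiv \<X> \<Y>"
    using in_quotient_imp_in_rel[OF equiv_rational_equiv] \<Phi> f(1) g(1)
    unfolding rational_maps_def by blast
  then obtain W where "dense_open \<X> W" "\<forall>Q\<in>W. f Q = g Q"
    unfolding rational_equiv_def by blast
  then show ?thesis
    using morphisms_eq_if_eq_on_dense[OF rational_mapsD(1)[OF \<Phi> f(1)] rational_mapsD(1)[OF \<Phi> g(1)]
        rational_mapsD(2)[OF \<Phi> f(1)] rational_mapsD(2)[OF \<Phi> g(1)]] f(2) g(2)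
    unfolding dense_open_def by blast
qed

lemma rat_apply_eq:
  assumes "\<Phi> \<in> rational_maps \<X> \<Y>" "(U, f) \<in> \<Phi>" "P \<in> U"
  shows "rat_apply \<Phi> P = f P"
  unfolding rat_apply_def
proof (rule the_equality)
  show "\<exists>(V, g)\<in>\<Phi>. P \<in> V \<and> f P = g P"
    using assms(2,3) by auto
  show "y = f P" if "\<exists>(V, g)\<in>\<Phi>. P \<in> V \<and> y = g P" for y
    using that rational_maps_representatives_eq[OF assms] by auto
qed

lemma rat_domain_subset:
  assumes "\<Phi> \<in> rational_maps \<X> \<Y>"
  shows "rat_domain \<Phi> \<subseteq> \<X>"
  using rational_mapsD(1)[OF assms] by (fastforce simp: rat_domain_def dest: openin_subset)

lemma continuous_map_rat_apply:
  assumes \<Phi>: "\<Phi> \<in> rational_maps \<X> \<Y>"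
  shows "continuous_map (zariski_on (rat_domain \<Phi>)) (zariski_on \<Y>) (rat_apply \<Phi>)"
proof (rule pasting_lemma[where I = \<Phi> and T = fst and f = snd])
  fix F assume "F \<in> \<Phi>"
  then obtain U f where F: "F = (U, f)" "(U, f) \<in> \<Phi>"
    by (cases F) auto
  have "U \<subseteq> rat_domain \<Phi>"
    using F(2) by (auto simp: rat_domain_def)
  then show "openin (zariski_on (rat_domain \<Phi>)) (fst F)"
    using rational_mapsD(1)[OF \<Phi> F(2)] rat_domain_subset[OF \<Phi>]
    by (fastforce simp: F(1) openin_subtopology)
  show "continuous_map (subtopology (zariski_on (rat_domain \<Phi>)) (fst F)) (zariski_on \<Y>) (snd F)"
    using rational_mapsD(2)[OF \<Phi> F(2)] \<open>U \<subseteq> rat_domain \<Phi>\<close>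
    by (simp add: F(1) morphism_def subtopology_subtopology inf_absorb2)
next
  fix F G P assume "F \<in> \<Phi>" "G \<in> \<Phi>" "P \<in> topspace (zariski_on (rat_domain \<Phi>)) \<inter> fst F \<inter> fst G"
  then show "snd F P = snd G P"
    using rational_maps_representatives_eq[OF \<Phi>, of "fst F" "snd F" P "fst G" "snd G"] by simp
next
  fix P assume "P \<in> topspace (zariski_on (rat_domain \<Phi>))"
  then show "\<exists>F. F \<in> \<Phi> \<and> P \<in> fst F \<and> rat_apply \<Phi> P = snd F P"
    using rat_apply_eq[OF \<Phi>] by (fastforce simp: rat_domain_def)
qed

lemma rat_iterate_in_domain:
  assumes \<Phi>: "\<Phi> \<in> rational_maps \<X> \<X>" and x: "x \<in> well_defined_orbit_points \<X> \<Phi>"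
  shows "rat_iterate \<Phi> n x \<in> rat_domain \<Phi>"
proof -
  have in_domain: "rat_iterate \<Phi> n x \<in> rat_domain \<Phi>" if "rat_iterate \<Phi> n x \<in> \<X>" for n
    using that x by (auto simp: well_defined_orbit_points_def indeterminacy_locus_def)
  show ?thesis
  proof (induction n)
    case 0
    have "x \<in> \<X>"
      using x by (simp add: well_defined_orbit_points_def)
    then show ?case
      using in_domain[of 0] by (simp add: rat_iterate_def)
  next
    case (Suc n)
    then have "rat_apply \<Phi> (rat_iterate \<Phi> n x) \<in> \<X>"
      using continuous_map_rat_apply[OF \<Phi>] by (auto simp: continuous_map_def Pi_iff)
    then show ?case
      using in_domain[of "Suc n"] by (simp add: rat_iterate_def)
  qed
qed

theorem theorem1p7:
  fixes \<X> \<Y> :: "'n::finite proj_space set"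
    and \<Phi> :: "('n, 'n) partial_map set"
    and x :: "'n proj_space"
  assumes "quasi_projective_variety \<X>"
    and "\<Phi> \<in> rational_maps \<X> \<X>"
    and "subvariety \<Y> \<X>"
    and "x \<in> well_defined_orbit_points \<X> \<Phi>"
  shows "\<exists>\<A> Z. finite \<A> \<and> (\<forall>A\<in>\<A>. arithmetic_progression A) \<and> upper_density Z = 0 \<and>
           {n. rat_iterate \<Phi> n x \<in> \<Y>} = \<Union>\<A> \<union> Z"
proof -
  have "progressions_up_to_density_zero (return_times (rat_apply \<Phi>) x \<Y>)"
  proof (rule return_times_noetherian_space)
    show "noetherian_space (zariski_on \<X>)"
      using noetherian_space_zariski by (rule noetherian_space_subtopology)
    show "continuous_map (subtopology (zariski_on \<X>) (rat_domain \<Phi>)) (zariski_on \<X>) (rat_apply \<Phi>)"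
      using continuous_map_rat_apply[OF assms(2)] rat_domain_subset[OF assms(2)]
      by (simp add: subtopology_subtopology inf_absorb2)
    show "(rat_apply \<Phi> ^^ n) x \<in> topspace (zariski_on \<X>) \<inter> rat_domain \<Phi>" for n
      using rat_iterate_in_domain[OF assms(2,4)] rat_domain_subset[OF assms(2)]
      by (auto simp: rat_iterate_def)
    show "closedin (zariski_on \<X>) \<Y>"
      using assms(3) by (simp add: subvariety_def)
  qed
  then show ?thesis
    by (simp add: progressions_up_to_density_zero_def return_times_def rat_iterate_def)
qed

end
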